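(* Let $p$ be a prime, $t\ge1$ an integer, and let $\Phi$ be an edge-monotone graph parameter with values in $\{0,1,\dots,c\}$, where $c<p$, that is nontrivial on $p^t$. Then there is a fixed point $H$ of $\mathrm{Syl}_{p^t}$ in $K_{p^t}$ that contains $K_{p^{t-1},p^{t-1}}$ as a subgraph and satisfies $\mathrm{ae}_\Phi(H)\not\equiv 0\pmod p$ (in particular $\mathrm{ae}_\Phi(H)\neq0$).
   Context: Graphs are finite, simple, undirected; a graph parameter is a computable isomorphism-invariant function on graphs; it is nontrivial on $n$ if not constant on $n$-vertex graphs; it is edge-monotone if $\Phi(G)\le\Phi(H)$ whenever $H$ is obtained from $G$ by deleting edges. The alternating enumerator is $\mathrm{ae}_\Phi(G)=\sum_{S\subseteq E(G)}\Phi((V(G),S))(-1)^{|S|}$. Identify $V(K_{p^t})$ with $\{0,\dots,p-1\}^t$. For functions $\varphi_j:\{0,\dots,p-1\}^j\to\{0,\dots,p-1\}$ ($0\le j<t$), define the bijection $\sigma_\varphi(x_1,\dots,x_t)=(x_1+\varphi_0,\,x_2+\varphi_1(x_1),\,\dots,\,x_t+\varphi_{t-1}(x_1,\dots,x_{t-1}))$ with arithmetic mod $p$; $\mathrm{Syl}_{p^t}$ is the group (under composition) of all such $\sigma_\varphi$, a subgroup of $\mathrm{Aut}(K_{p^t})$. A group element $g$ acts on an edge-subgraph $A$ of $K_{p^t}$ (same vertex set, subset of edges) by $gA=(V(A),\{\{g(u),g(v)\}:\{u,v\}\in E(A)\})$; $A$ is a fixed point of $\mathrm{Syl}_{p^t}$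 in $K_{p^t}$ if $gA=A$ for all $g\in\mathrm{Syl}_{p^t}$. *)

theory Defs
  imports Complex_Main "HOL-Library.Nat_Bijection" "HOL-Number_Theory.Cong"
    "HOL-Computational_Algebra.Primes"
begin

type_synonym 'v graph = "'v set \<times> 'v set set"

abbreviation verts :: "'v graph \<Rightarrow> 'v set" where "verts G \<equiv> fst G"
abbreviation edges :: "'v graph \<Rightarrow> 'v set set" where "edges G \<equiv> snd G"

definition all_pairs :: "'v set \<Rightarrow> 'v set set" where
  "all_pairs V = {{u, v} | u v. u \<in> V \<and> v \<in> V \<and> u \<noteq> v}"

definition is_graph :: "'v graph \<Rightarrow> bool" where
  "is_graph G \<longleftrightarrow> finite (verts G) \<and> edges G \<subseteq> all_pairs (verts G)"

definition graph_iso :: "'v graph \<Rightarrow> 'w graph \<Rightarrow> bool" where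
  "graph_iso G H \<longleftrightarrow> (\<exists>f. bij_betw f (verts G) (verts H) \<and>
     (\<forall>u\<in>verts G. \<forall>v\<in>verts G. {u, v} \<in> edges G \<longleftrightarrow> {f u, f v} \<in> edges H))"

definition contains_subgraph :: "'v graph \<Rightarrow> 'w graph \<Rightarrow> bool" where
  "contains_subgraph H F \<longleftrightarrow> (\<exists>f. inj_on f (verts F) \<and> f ` verts F \<subseteq> verts H \<and>
     (\<forall>u v. {u, v} \<in> edges F \<longrightarrow> {f u, f v} \<in> edges H))"

definition complete_bipartite :: "nat \<Rightarrow> nat \<Rightarrow> (nat + nat) graph" where
  "complete_bipartite m n =
     (Inl ` {..<m} \<union> Inr ` {..<n}, {{Inl i, Inr j} | i j. i < m \<and> j < n})"


text \<open>Computability is rendered by Kleene's partial recursive functions. The relation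
  \<open>rec_eval f xs y\<close> says that the function described by \<open>f\<close> is defined on the
  arguments \<open>xs\<close> and has value \<open>y\<close> there; the first argument of \<open>RPrec\<close> is the
  recursion argument and that of the body of \<open>RMu\<close> is the one minimised over.\<close>

datatype recf = RZero | RSucc | RProj nat | RComp recf "recf list" | RPrec recf recf | RMu recf

inductive rec_eval :: "recf \<Rightarrow> nat list \<Rightarrow> nat \<Rightarrow> bool" where
  "rec_eval RZero xs 0"
| "rec_eval RSucc [x] (Suc x)"
| "i < length xs \<Longrightarrow> rec_eval (RProj i) xs (xs ! i)"
| "list_all2 (\<lambda>g y. rec_eval g xs y) gs ys \<Longrightarrow> rec_eval f ys z \<Longrightarrow> rec_eval (RComp f gs) xs z"
| "rec_eval f xs y \<Longrightarrow> rec_eval (RPrec f g) (0 # xs) y"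
| "rec_eval (RPrec f g) (n # xs) y \<Longrightarrow> rec_eval g (n # y # xs) z \<Longrightarrow>
     rec_eval (RPrec f g) (Suc n # xs) z"
| "rec_eval f (n # xs) 0 \<Longrightarrow> (\<forall>m<n. \<exists>y. rec_eval f (m # xs) (Suc y)) \<Longrightarrow> rec_eval (RMu f) xs n"

text \<open>Graphs that serve as arguments of parameters have their vertices in the countably
  infinite type \<open>nat list\<close>. Every finite graph is isomorphic to such a graph, and
  the vertex set \<open>{0,\<dots>,p-1}\<^sup>t\<close> lies in this type.\<close>

definition graph_code :: "nat list graph \<Rightarrow> nat" where
  "graph_code G = prod_encode (set_encode (list_encode ` verts G),
     set_encode ((\<lambda>e. set_encode (list_encode ` e)) ` edges G))"

definition computable_on_graphs :: "(nat list graph \<Rightarrow> nat) \<Rightarrow> bool" where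
  "computable_on_graphs \<Phi> \<longleftrightarrow> (\<exists>f. \<forall>G. is_graph G \<longrightarrow> rec_eval f [graph_code G] (\<Phi> G))"

definition graph_parameter :: "(nat list graph \<Rightarrow> nat) \<Rightarrow> bool" where
  "graph_parameter \<Phi> \<longleftrightarrow> computable_on_graphs \<Phi> \<and>
     (\<forall>G H. is_graph G \<longrightarrow> is_graph H \<longrightarrow> graph_iso G H \<longrightarrow> \<Phi> G = \<Phi> H)"

definition nontrivial_on :: "(nat list graph \<Rightarrow> nat) \<Rightarrow> nat \<Rightarrow> bool" where
  "nontrivial_on \<Phi> n \<longleftrightarrow> (\<exists>G H. is_graph G \<and> is_graph H \<and>
     card (verts G) = n \<and> card (verts H) = n \<and> \<Phi> G \<noteq> \<Phi> H)"

definition edge_monotone :: "(nat list graph \<Rightarrow> nat) \<Rightarrow> bool" where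
  "edge_monotone \<Phi> \<longleftrightarrow> (\<forall>G H. is_graph G \<longrightarrow> is_graph H \<longrightarrow>
     verts H = verts G \<longrightarrow> edges H \<subseteq> edges G \<longrightarrow> \<Phi> G \<le> \<Phi> H)"

definition alt_enum :: "(nat list graph \<Rightarrow> nat) \<Rightarrow> nat list graph \<Rightarrow> int" where
  "alt_enum \<Phi> G = (\<Sum>S\<in>Pow (edges G). int (\<Phi> (verts G, S)) * (-1) ^ card S)"


definition tuples :: "nat \<Rightarrow> nat \<Rightarrow> nat list set" where
  "tuples p j = {xs. length xs = j \<and> set xs \<subseteq> {0..<p}}"

definition complete_graph :: "nat \<Rightarrow> nat \<Rightarrow> nat list graph" where
  "complete_graph p t = (tuples p t, all_pairs (tuples p t))"

text \<open>Coordinates are counted from 0, so coordinate \<open>j\<close> is shifted by \<open>\<phi> j\<close> applied to the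
  \<open>j\<close> coordinates before it.\<close>

definition syl_map :: "nat \<Rightarrow> nat \<Rightarrow> (nat \<Rightarrow> nat list \<Rightarrow> nat) \<Rightarrow> nat list \<Rightarrow> nat list" where
  "syl_map p t \<phi> xs = map (\<lambda>j. (xs ! j + \<phi> j (take j xs)) mod p) [0..<t]"

definition Syl :: "nat \<Rightarrow> nat \<Rightarrow> (nat list \<Rightarrow> nat list) set" where
  "Syl p t = {syl_map p t \<phi> | \<phi>. \<forall>j<t. \<forall>xs\<in>tuples p j. \<phi> j xs \<in> {0..<p}}"

definition graph_act :: "('v \<Rightarrow> 'v) \<Rightarrow> 'v graph \<Rightarrow> 'v graph" where
  "graph_act g A = (verts A, {{g u, g v} | u v. {u, v} \<in> edges A})"

definition Syl_fixed_point :: "nat \<Rightarrow> nat \<Rightarrow> nat list graph \<Rightarrow> bool" where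
  "Syl_fixed_point p t A \<longleftrightarrow>
     verts A = verts (complete_graph p t) \<and> edges A \<subseteq> edges (complete_graph p t) \<and>
     (\<forall>g\<in>Syl p t. graph_act g A = A)"

end

theory Submission
  imports Defs "HOL-Algebra.Group_Action"
begin

text \<open>
  Let \<open>\<Gamma>\<close> be the group \<open>Syl p t\<close>, a \<open>p\<close>-group. Modulo \<open>p\<close>, the alternating enumerator of a
  \<open>\<Gamma>\<close>-invariant edge set \<open>H\<close> only sees the invariant subsets of \<open>H\<close>, and every edge orbit \<open>O\<close>
  satisfies \<open>(-1)\<^bsup>|O|\<^esup> = -1\<close> modulo \<open>p\<close>, its size being a power of \<open>p\<close>. Let \<open>M\<close> be the set of pairs
  of tuples with different first coordinates; an invariant \<open>H\<close> meeting \<open>M\<close> contains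
  \<open>K\<^bsub>q,q\<^esub>\<close> with \<open>q = p\<^bsup>t-1\<^esup>\<close>. If the enumerator vanished modulo \<open>p\<close> for all such \<open>H\<close>, then
  induction over the invariant sets would give \<open>\<Phi>(A) = \<Phi>(A - M)\<close> for every invariant \<open>A\<close>.
  Apply this to the set \<open>E\<^sub>n\<close> of pairs that differ in one of the first \<open>n\<close> coordinates: a cyclic
  rotation of the coordinates maps \<open>E\<^bsub>n+1\<^esub> - M\<close> into \<open>E\<^sub>n\<close>, so
  \<open>\<Phi>(E\<^bsub>n+1\<^esub>) = \<Phi>(E\<^bsub>n+1\<^esub> - M) \<ge> \<Phi>(E\<^sub>n)\<close>. Hence \<open>\<Phi>\<close> is at least as large on the complete graph as
  on the empty graph, and by monotonicity it is constant.
\<close>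

section \<open>Invariant sets and orbits of a group action\<close>

definition invariant_sets :: "[_, 'b set, 'a \<Rightarrow> 'b \<Rightarrow> 'b] \<Rightarrow> 'b set set" where
  "invariant_sets G E \<phi> = {A. A \<subseteq> E \<and> (\<forall>g \<in> carrier G. \<phi> g ` A = A)}"

context group_action
begin

lemma action_inv_cancel:
  assumes "g \<in> carrier G" "x \<in> E"
  shows "\<phi> g (\<phi> (inv g) x) = x"
proof -
  interpret group G
    using group_hom group_hom.axioms(1) by auto
  show ?thesis
    using orbit_sym_aux[of "inv g" x] assms by simp
qed

text \<open>Used at two levels: from tuples to edges, and from edges to edge sets. The restriction
  to \<open>Pow E\<close> makes the maps extensional, as elements of \<open>BijGroup\<close> have to
  be.\<close>

lemma group_action_Pow: "group_action G (Pow E) (\<lambda>g. \<lambda>S \<in> Pow E. \<phi> g ` S)"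
proof -
  interpret group G
    using group_hom group_hom.axioms(1) by auto
  have bij: "(\<lambda>S \<in> Pow E. \<phi> g ` S) \<in> Bij (Pow E)" if "g \<in> carrier G" for g
  proof -
    have "bij_betw (\<phi> g) E E"
      using that inj_prop surj_prop by (simp add: bij_betw_def)
    then have "bij_betw ((`) (\<phi> g)) (Pow E) (Pow E)"
      by (rule bij_betw_Pow)
    then show ?thesis
      by (simp add: Bij_def)
  qed
  show ?thesis
  proof (intro group_action.intro group_hom.intro group_hom_axioms.intro homI)
    fix g h assume gh: "g \<in> carrier G" "h \<in> carrier G"
    have "\<phi> (g \<otimes> h) ` S = \<phi> g ` \<phi> h ` S" if "S \<subseteq> E" for S
      using that gh composition_rule by (force simp: image_image)
    moreover have "\<phi> h ` S \<subseteq> E" if "S \<subseteq> E" for S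
      using that gh surj_prop by blast
    ultimately show "(\<lambda>S \<in> Pow E. \<phi> (g \<otimes> h) ` S) =
        (\<lambda>S \<in> Pow E. \<phi> g ` S) \<otimes>\<^bsub>BijGroup (Pow E)\<^esub> (\<lambda>S \<in> Pow E. \<phi> h ` S)"
      using bij gh by (auto simp: BijGroup_def compose_def fun_eq_iff)
  qed (use bij in \<open>auto simp: is_group group_BijGroup, simp add: BijGroup_def\<close>)
qed

text \<open>Inclusion suffices, since the inverse of \<open>g\<close> also maps \<open>A\<close>
  into itself.\<close>

lemma invariant_setsI:
  assumes "A \<subseteq> E" "\<And>g x. g \<in> carrier G \<Longrightarrow> x \<in> A \<Longrightarrow> \<phi> g x \<in> A"
  shows "A \<in> invariant_sets G E \<phi>"
proof -
  interpret group G
    using group_hom group_hom.axioms(1) by auto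
  have "\<phi> g ` A = A" if g: "g \<in> carrier G" for g
  proof
    show "A \<subseteq> \<phi> g ` A"
      using action_inv_cancel[OF g] assms g by (metis image_eqI inv_closed subset_iff subsetI)
  qed (use assms g in blast)
  then show ?thesis
    using assms by (simp add: invariant_sets_def)
qed

lemma invariant_sets_Un:
  "A \<in> invariant_sets G E \<phi> \<Longrightarrow> B \<in> invariant_sets G E \<phi> \<Longrightarrow> A \<union> B \<in> invariant_sets G E \<phi>"
  by (auto simp: invariant_sets_def image_Un)

lemma invariant_sets_Diff:
  assumes "A \<in> invariant_sets G E \<phi>" "B \<in> invariant_sets G E \<phi>"
  shows "A - B \<in> invariant_sets G E \<phi>"
proof -
  have "\<phi> g ` (A - B) = \<phi> g ` A - \<phi> g ` B" if "g \<in> carrier G" for g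
    by (rule inj_on_image_set_diff[OF inj_prop[OF that]]) (use assms in \<open>auto simp: invariant_sets_def\<close>)
  then show ?thesis
    using assms by (auto simp: invariant_sets_def)
qed

lemma orbit_invariant:
  assumes "x \<in> E" shows "orbit G \<phi> x \<in> invariant_sets G E \<phi>"
proof (rule invariant_setsI)
  interpret group G
    using group_hom group_hom.axioms(1) by auto
  show "orbit G \<phi> x \<subseteq> E"
    using assms element_image by (auto simp: orbit_def)
  show "\<phi> g y \<in> orbit G \<phi> x" if "g \<in> carrier G" "y \<in> orbit G \<phi> x" for g y
    using that assms by (auto simp: orbit_def) (metis composition_rule m_closed)
qed

lemma orbit_subset_invariant:
  "A \<in> invariant_sets G E \<phi> \<Longrightarrow> x \<in> A \<Longrightarrow> orbit G \<phi> x \<subseteq> A"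
  by (auto simp: orbit_def invariant_sets_def)

lemma invariant_set_orbit_dichotomy:
  assumes "A \<in> invariant_sets G E \<phi>" "x \<in> E"
  shows "orbit G \<phi> x \<subseteq> A \<or> orbit G \<phi> x \<inter> A = {}"
proof (cases "orbit G \<phi> x \<inter> A = {}")
  case False
  then obtain y where y: "y \<in> orbit G \<phi> x" "y \<in> A" by blast
  then have "x \<in> orbit G \<phi> y"
    using assms orbit_sym by (auto simp: invariant_sets_def)
  then have "x \<in> A"
    using orbit_subset_invariant[OF assms(1) y(2)] by blast
  then show ?thesis
    using orbit_subset_invariant[OF assms(1)] by blast
qed simp

section \<open>Sums modulo p under the action of a p-group\<close>

lemma card_orbit_prime_power:
  assumes "x \<in> E" "prime p" "order G = p ^ k"
  obtains i where "card (orbit G \<phi> x) = p ^ i"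
proof -
  have "card (orbit G \<phi> x) dvd p ^ k"
    using orbit_stabilizer_theorem[OF assms(1)] assms(3) by (metis dvd_triv_left)
  then show thesis
    using that divides_primepow_nat[OF assms(2)] by blast
qed

text \<open>The weighted form of the fixed point count for p-groups: \<open>w\<close> is constant on
  each orbit, and an orbit with more than one point has size divisible by \<open>p\<close>, so it
  contributes 0.\<close>

lemma sum_cong_sum_fixed_points:
  fixes w :: "_ \<Rightarrow> int"
  assumes "finite E" "prime p" "order G = p ^ k"
    and w: "\<And>g x. g \<in> carrier G \<Longrightarrow> x \<in> E \<Longrightarrow> w (\<phi> g x) = w x"
  shows "[(\<Sum>x\<in>E. w x) = (\<Sum>x | x \<in> E \<and> (\<forall>g \<in> carrier G. \<phi> g x = x). w x)] (mod int p)"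
proof -
  define F where "F = {x \<in> E. \<forall>g \<in> carrier G. \<phi> g x = x}"
  have "[(\<Sum>x\<in>orb. w x) = (\<Sum>x\<in>orb. if x \<in> F then w x else 0)] (mod int p)"
    if "orb \<in> orbits G E \<phi>" for orb
  proof -
    obtain x where x: "x \<in> E" "orb = orbit G \<phi> x"
      using \<open>orb \<in> _\<close> by (auto simp: orbits_def)
    obtain i where i: "card orb = p ^ i"
      using card_orbit_prime_power[OF x(1) assms(2,3)] x(2) by auto
    have xo: "x \<in> orb"
      using x orbit_refl by simp
    show ?thesis
    proof (cases "x \<in> F")
      case True
      then have "orb = {x}"
        using x xo by (auto simp: F_def orbit_def)
      then show ?thesis
        using True by simp
    next
      case False
      have "orb \<noteq> {x}"
        using False x by (auto simp: F_def orbit_def)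
      then have "i \<noteq> 0"
        using i xo by (auto simp: card_1_singleton_iff)
      have "y \<notin> F" if "y \<in> orb" for y
      proof
        assume "y \<in> F"
        then have "orbit G \<phi> y \<subseteq> {y}"
          by (auto simp: F_def orbit_def)
        moreover have "x \<in> orbit G \<phi> y"
          using x that orbit_sym \<open>y \<in> F\<close> by (auto simp: F_def)
        ultimately show False
          using False \<open>y \<in> F\<close> by auto
      qed
      then have "(\<Sum>y\<in>orb. if y \<in> F then w y else 0) = 0"
        by simp
      moreover have "(\<Sum>y\<in>orb. w y) = (\<Sum>y\<in>orb. w x)"
        using x w by (intro sum.cong) (auto simp: orbit_def)
      then have "(\<Sum>y\<in>orb. w y) = int p ^ i * w x"
        using i by simp
      ultimately show ?thesis
        using \<open>i \<noteq> 0\<close> by (simp add: cong_0_iff)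
    qed
  qed
  then have "[(\<Sum>orb\<in>orbits G E \<phi>. \<Sum>x\<in>orb. w x) =
      (\<Sum>orb\<in>orbits G E \<phi>. \<Sum>x\<in>orb. if x \<in> F then w x else 0)] (mod int p)"
    by (rule cong_sum)
  then have "[(\<Sum>x\<in>E. w x) = (\<Sum>x\<in>E. if x \<in> F then w x else 0)] (mod int p)"
    by (simp add: disjoint_sum[OF assms(1)])
  moreover have "(\<Sum>x\<in>E. if x \<in> F then w x else 0) = (\<Sum>x\<in>F. w x)"
    using assms(1) by (intro sum.mono_neutral_cong_right) (auto simp: F_def)
  ultimately show ?thesis
    by (simp add: F_def)
qed

text \<open>The fixed points of the action on \<open>Pow E\<close> are exactly the invariant
  sets.\<close>

lemma sum_Pow_cong_sum_invariant:
  fixes f :: "_ set \<Rightarrow> int"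
  assumes "finite E" "prime p" "order G = p ^ k" and A: "A \<in> invariant_sets G E \<phi>"
    and f: "\<And>g S. g \<in> carrier G \<Longrightarrow> S \<subseteq> A \<Longrightarrow> f (\<phi> g ` S) = f S"
  shows "[(\<Sum>S\<in>Pow A. f S) = (\<Sum>S | S \<in> invariant_sets G E \<phi> \<and> S \<subseteq> A. f S)] (mod int p)"
proof -
  interpret P: group_action G "Pow E" "\<lambda>g. \<lambda>S \<in> Pow E. \<phi> g ` S"
    by (rule group_action_Pow)
  \<comment> \<open>Extension by zero: the group acts on all of \<open>Pow E\<close>, and invariance
    of \<open>A\<close> keeps \<open>w\<close> constant on orbits.\<close>
  define w where "w S = (if S \<subseteq> A then f S else 0)" for S
  have AE: "A \<subseteq> E"
    using A by (simp add: invariant_sets_def)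
  have sub: "\<phi> g ` S \<subseteq> A \<longleftrightarrow> S \<subseteq> A" if "g \<in> carrier G" "S \<subseteq> E" for g S
  proof -
    have "\<phi> g ` S \<subseteq> \<phi> g ` A \<longleftrightarrow> S \<subseteq> A"
      using inj_on_image_mem_iff[OF inj_prop[OF that(1)]] that AE by blast
    then show ?thesis
      using A that by (simp add: invariant_sets_def)
  qed
  have "[(\<Sum>S\<in>Pow E. w S) = (\<Sum>S | S \<in> Pow E \<and> (\<forall>g \<in> carrier G. (\<lambda>S \<in> Pow E. \<phi> g ` S) S = S). w S)] (mod int p)"
    by (rule P.sum_cong_sum_fixed_points) (use assms sub in \<open>auto simp: w_def\<close>)
  moreover have "(\<Sum>S\<in>Pow E. w S) = (\<Sum>S\<in>Pow A. f S)"
    using assms(1) AE by (intro sum.mono_neutral_cong_right) (auto simp: w_def)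
  moreover have "(\<Sum>S | S \<in> Pow E \<and> (\<forall>g \<in> carrier G. (\<lambda>S \<in> Pow E. \<phi> g ` S) S = S). w S)
      = (\<Sum>S | S \<in> invariant_sets G E \<phi> \<and> S \<subseteq> A. f S)"
  proof -
    have "{S. S \<in> Pow E \<and> (\<forall>g \<in> carrier G. (\<lambda>S \<in> Pow E. \<phi> g ` S) S = S)} = invariant_sets G E \<phi>"
      by (simp add: invariant_sets_def cong: conj_cong)
    moreover have "finite (invariant_sets G E \<phi>)"
      using assms(1) by (simp add: invariant_sets_def)
    ultimately show ?thesis
      by (auto intro!: sum.mono_neutral_cong_right simp: w_def split: if_splits)
  qed
  ultimately show ?thesis
    by simp
qed

text \<open>For odd \<open>p\<close> the orbit size, a power of \<open>p\<close>, is odd; for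
  \<open>p = 2\<close> the two signs agree modulo 2.\<close>

lemma neg_one_power_card_orbit_cong:
  assumes "x \<in> E" "prime p" "order G = p ^ k"
  shows "[(-1) ^ card (orbit G \<phi> x) = (-1 :: int)] (mod int p)"
proof -
  obtain i where i: "card (orbit G \<phi> x) = p ^ i"
    using card_orbit_prime_power[OF assms] by blast
  show ?thesis
  proof (cases "p = 2")
    case True
    then show ?thesis
      by (cases "even (card (orbit G \<phi> x))") (simp_all add: cong_iff_dvd_diff)
  next
    case False
    then have "odd (card (orbit G \<phi> x))"
      using i assms(2) prime_odd_nat[of p] prime_gt_1_nat[of p] by auto
    then show ?thesis
      by simp
  qed
qed

text \<open>An invariant set contains the orbit or avoids it, and adding the orbit is a bijection
  from the sets avoiding it to the sets containing it.\<close>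

lemma invariant_sum_insert_orbit:
  fixes f :: "_ set \<Rightarrow> int"
  assumes "finite E" "A \<in> invariant_sets G E \<phi>" "x \<in> A"
  shows "(\<Sum>S | S \<in> invariant_sets G E \<phi> \<and> S \<subseteq> A. f S)
    = (\<Sum>S | S \<in> invariant_sets G E \<phi> \<and> S \<subseteq> A - orbit G \<phi> x. f S + f (S \<union> orbit G \<phi> x))"
proof -
  let ?O = "orbit G \<phi> x"
  define T where "T = {S. S \<in> invariant_sets G E \<phi> \<and> S \<subseteq> A - ?O}"
  have AE: "A \<subseteq> E" "x \<in> E"
    using assms by (auto simp: invariant_sets_def)
  have O: "?O \<in> invariant_sets G E \<phi>" "?O \<subseteq> A" "x \<in> ?O"
    using orbit_invariant orbit_subset_invariant orbit_refl assms AE by auto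
  have "finite T"
    using assms(1) by (rule_tac finite_subset[of _ "Pow E"]) (auto simp: T_def invariant_sets_def)
  have eq: "{S. S \<in> invariant_sets G E \<phi> \<and> S \<subseteq> A} = T \<union> (\<lambda>S. S \<union> ?O) ` T"
  proof (intro equalityI subsetI)
    fix S assume "S \<in> {S. S \<in> invariant_sets G E \<phi> \<and> S \<subseteq> A}"
    then have S: "S \<in> invariant_sets G E \<phi>" "S \<subseteq> A" by auto
    consider "?O \<subseteq> S" | "?O \<inter> S = {}"
      using invariant_set_orbit_dichotomy[OF S(1) AE(2)] by blast
    then show "S \<in> T \<union> (\<lambda>S. S \<union> ?O) ` T"
    proof cases
      case 1
      then have "S = (S - ?O) \<union> ?O" "S - ?O \<in> T"
        using S O invariant_sets_Diff by (auto simp: T_def)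
      then show ?thesis by blast
    next
      case 2
      then show ?thesis
        using S by (auto simp: T_def)
    qed
  qed (use O invariant_sets_Un in \<open>auto simp: T_def\<close>)
  have "inj_on (\<lambda>S. S \<union> ?O) T"
    by (rule inj_onI) (auto simp: T_def)
  moreover have "T \<inter> (\<lambda>S. S \<union> ?O) ` T = {}"
    using O(3) by (auto simp: T_def)
  ultimately show ?thesis
    unfolding eq T_def[symmetric]
    using \<open>finite T\<close> by (simp add: sum.union_disjoint sum.reindex sum.distrib)
qed

text \<open>Compare the signed sums of \<open>f S\<close> and of \<open>f (S - M)\<close> over the
  invariant \<open>S \<subseteq> A\<close>. If \<open>A\<close> meets \<open>M\<close>, the first
  vanishes by hypothesis and the second because toggling an orbit inside \<open>M\<close> cancels
  its terms in pairs. By induction the terms with \<open>S \<noteq> A\<close> agree, so those at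
  \<open>A\<close> agree too.\<close>

theorem invariant_cong_remove:
  fixes f :: "_ set \<Rightarrow> int"
  assumes "finite E" "prime p" "order G = p ^ k"
    and M: "M \<in> invariant_sets G E \<phi>"
    and "A \<in> invariant_sets G E \<phi>"
    and "\<And>g S. g \<in> carrier G \<Longrightarrow> S \<subseteq> A \<Longrightarrow> f (\<phi> g ` S) = f S"
    and "\<And>H. H \<in> invariant_sets G E \<phi> \<Longrightarrow> H \<subseteq> A \<Longrightarrow> H \<inter> M \<noteq> {} \<Longrightarrow>
      [(\<Sum>S\<in>Pow H. f S * (-1) ^ card S) = 0] (mod int p)"
  shows "[f A = f (A - M)] (mod int p)"
  using assms(5-)
proof (induction "card A" arbitrary: A rule: less_induct)
  case (less A)
  note A = less.prems(1) and f_inv = less.prems(2) and vanish = less.prems(3)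
  let ?I = "\<lambda>A. {S. S \<in> invariant_sets G E \<phi> \<and> S \<subseteq> A}"
  have AE: "A \<subseteq> E" "finite A"
    using A assms(1) finite_subset by (auto simp: invariant_sets_def)
  have fin: "finite (?I A)"
    using AE by (rule_tac finite_subset[of _ "Pow A"]) auto
  show ?case
  proof (cases "A \<inter> M = {}")
    case True
    then have "A - M = A" by blast
    then show ?thesis by simp
  next
    case False
    then obtain x where x: "x \<in> A" "x \<in> M" by blast
    let ?O = "orbit G \<phi> x"
    have xE: "x \<in> E"
      using x AE by blast
    have OM: "?O \<subseteq> M"
      using orbit_subset_invariant[OF M x(2)] .
    have finO: "finite ?O"
      using orbit_subset_invariant[OF A x(1)] AE finite_subset by blast
    have card_inv: "card (\<phi> g ` S) = card S" if "g \<in> carrier G" "S \<subseteq> A" for g S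
      using that AE inj_prop[OF that(1)] by (intro card_image) (meson inj_on_subset subset_trans)
    have "[(\<Sum>S\<in>Pow A. f S * (-1) ^ card S) = (\<Sum>S\<in>?I A. f S * (-1) ^ card S)] (mod int p)"
      by (rule sum_Pow_cong_sum_invariant[OF assms(1-3) A]) (use f_inv card_inv in auto)
    moreover have "[(\<Sum>S\<in>Pow A. f S * (-1) ^ card S) = 0] (mod int p)"
      by (rule vanish) (use A False in auto)
    ultimately have sum0: "[(\<Sum>S\<in>?I A. f S * (-1) ^ card S) = 0] (mod int p)"
      using cong_sym cong_trans by blast
    \<comment> \<open>Adding the orbit leaves \<open>S - M\<close> unchanged, as the orbit lies in
      \<open>M\<close>, but flips the sign modulo \<open>p\<close>.\<close>
    have "[f (S - M) * (-1) ^ card S + f ((S \<union> ?O) - M) * (-1) ^ card (S \<union> ?O) = 0] (mod int p)"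
      if "S \<in> ?I (A - ?O)" for S
    proof -
      have "finite S" "S \<inter> ?O = {}"
        using that AE finite_subset by auto
      then have "card (S \<union> ?O) = card S + card ?O"
        using finO by (simp add: card_Un_disjoint)
      moreover have "(S \<union> ?O) - M = S - M"
        using OM by blast
      moreover have "[f (S - M) * (-1) ^ card S + f (S - M) * (-1) ^ card S * (-1) ^ card ?O
          = f (S - M) * (-1) ^ card S + f (S - M) * (-1) ^ card S * (-1)] (mod int p)"
        by (intro cong_add cong_mult cong_refl neg_one_power_card_orbit_cong[OF xE assms(2,3)])
      ultimately show ?thesis
        by (simp add: power_add mult.assoc)
    qed
    then have "[(\<Sum>S\<in>?I (A - ?O). f (S - M) * (-1) ^ card S
        + f ((S \<union> ?O) - M) * (-1) ^ card (S \<union> ?O)) = (\<Sum>S\<in>?I (A - ?O). 0)] (mod int p)"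
      by (rule cong_sum)
    then have toggle: "[(\<Sum>S\<in>?I A. f (S - M) * (-1) ^ card S) = 0] (mod int p)"
      using invariant_sum_insert_orbit[OF assms(1) A x(1), of "\<lambda>S. f (S - M) * (-1) ^ card S"]
      by simp
    have IH: "[f S * (-1) ^ card S = f (S - M) * (-1) ^ card S] (mod int p)" if "S \<in> ?I A - {A}" for S
    proof (intro cong_mult cong_refl less.hyps)
      show "card S < card A"
        using that AE by (intro psubset_card_mono) auto
      show "S \<in> invariant_sets G E \<phi>"
        using that by simp
      show "f (\<phi> g ` R) = f R" if "g \<in> carrier G" "R \<subseteq> S" for g R
        using f_inv[OF that(1)] that(2) \<open>S \<in> ?I A - {A}\<close> by blast
      show "[(\<Sum>S\<in>Pow H. f S * (-1) ^ card S) = 0] (mod int p)"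
        if "H \<in> invariant_sets G E \<phi>" "H \<subseteq> S" "H \<inter> M \<noteq> {}" for H
        using vanish[of H] that \<open>S \<in> ?I A - {A}\<close> by blast
    qed
    have "[(\<Sum>S\<in>?I A - {A}. f S * (-1) ^ card S) = (\<Sum>S\<in>?I A - {A}. f (S - M) * (-1) ^ card S)] (mod int p)"
      using IH by (rule cong_sum)
    moreover have "(\<Sum>S\<in>?I A. h S) = h A + (\<Sum>S\<in>?I A - {A}. h S)" for h :: "_ \<Rightarrow> int"
      using fin A by (intro sum.remove) auto
    \<comment> \<open>Both full sums are 0 modulo \<open>p\<close>; subtracting the congruent parts
      over \<open>S \<noteq> A\<close> isolates the terms at \<open>A\<close>.\<close>
    ultimately have "[f A * (-1) ^ card A + (\<Sum>S\<in>?I A - {A}. f S * (-1) ^ card S)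
        - (\<Sum>S\<in>?I A - {A}. f S * (-1) ^ card S)
        = f (A - M) * (-1) ^ card A + (\<Sum>S\<in>?I A - {A}. f (S - M) * (-1) ^ card S)
        - (\<Sum>S\<in>?I A - {A}. f (S - M) * (-1) ^ card S)] (mod int p)"
      using cong_trans[OF sum0 cong_sym[OF toggle]] by (intro cong_diff) simp_all
    then have "[f A * (-1) ^ card A = f (A - M) * (-1) ^ card A] (mod int p)"
      by simp
    then show ?thesis
      by (cases "even (card A)") (simp_all add: cong_minus_minus_iff)
  qed
qed

end

section \<open>The Sylow group as a group of permutations of the tuples\<close>

text \<open>A map in \<open>Syl p t\<close> shifts coordinate \<open>n\<close> by an amount that
  depends only on the prefix before it. Tuples with a common prefix of length \<open>n\<close> are
  therefore shifted equally there, and their difference \<open>d\<close> modulo \<open>p\<close> is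
  preserved.\<close>

definition shift_related :: "nat \<Rightarrow> nat \<Rightarrow> nat \<Rightarrow> nat list \<Rightarrow> nat list \<Rightarrow> bool" where
  "shift_related p n d x y \<longleftrightarrow> take n x = take n y \<and> [x ! n + d = y ! n] (mod p)"

text \<open>These are the restrictions to the tuples of the maps in \<open>Syl p t\<close>. Describing them as the
  bijections that preserve all relations \<open>shift_related p n d\<close> makes the group axioms immediate.\<close>

definition syl_perms :: "nat \<Rightarrow> nat \<Rightarrow> (nat list \<Rightarrow> nat list) set" where
  "syl_perms p t = {g \<in> Bij (tuples p t). \<forall>n<t. \<forall>d. \<forall>x\<in>tuples p t. \<forall>y\<in>tuples p t.
     shift_related p n d (g x) (g y) \<longleftrightarrow> shift_related p n d x y}"

definition syl_group :: "nat \<Rightarrow> nat \<Rightarrow> (nat list \<Rightarrow> nat list) monoid" where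
  "syl_group p t = BijGroup (tuples p t)\<lparr>carrier := syl_perms p t\<rparr>"

lemma carrier_syl_group [simp]: "carrier (syl_group p t) = syl_perms p t"
  by (simp add: syl_group_def)

lemma subgroup_syl_perms: "subgroup (syl_perms p t) (BijGroup (tuples p t))"
proof
  show "syl_perms p t \<subseteq> carrier (BijGroup (tuples p t))"
    by (auto simp: syl_perms_def BijGroup_def)
  show "\<one>\<^bsub>BijGroup (tuples p t)\<^esub> \<in> syl_perms p t"
    by (auto simp: syl_perms_def BijGroup_def id_Bij)
next
  fix g h assume g: "g \<in> syl_perms p t" and h: "h \<in> syl_perms p t"
  then have "h x \<in> tuples p t" if "x \<in> tuples p t" for x
    using that Bij_imp_funcset by (fastforce simp: syl_perms_def)
  with g h show "g \<otimes>\<^bsub>BijGroup (tuples p t)\<^esub> h \<in> syl_perms p t"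
    by (simp add: syl_perms_def BijGroup_def compose_Bij) (simp add: compose_def)
next
  fix g assume g: "g \<in> syl_perms p t"
  then have gB: "g \<in> Bij (tuples p t)"
    by (simp add: syl_perms_def)
  then have inv: "inv_into (tuples p t) g x \<in> tuples p t" "g (inv_into (tuples p t) g x) = x"
    if "x \<in> tuples p t" for x
    using that by (auto simp: Bij_def bij_betw_def intro: inv_into_into f_inv_into_f)
  have "shift_related p n d (inv_into (tuples p t) g x) (inv_into (tuples p t) g y)
      \<longleftrightarrow> shift_related p n d x y" if "n < t" "x \<in> tuples p t" "y \<in> tuples p t" for n d x y
  proof -
    have "shift_related p n d (g (inv_into (tuples p t) g x)) (g (inv_into (tuples p t) g y))
        \<longleftrightarrow> shift_related p n d (inv_into (tuples p t) g x) (inv_into (tuples p t) g y)"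
      using g that(1) inv(1)[OF that(2)] inv(1)[OF that(3)] by (simp add: syl_perms_def)
    then show ?thesis
      by (simp add: inv(2) that)
  qed
  then show "inv\<^bsub>BijGroup (tuples p t)\<^esub> g \<in> syl_perms p t"
    using restrict_inv_into_Bij[OF gB] by (simp add: inv_BijGroup[OF gB] syl_perms_def)
qed

lemma group_action_syl_group: "group_action (syl_group p t) (tuples p t) (\<lambda>g. g)"
proof -
  interpret B: group "BijGroup (tuples p t)"
    by (rule group_BijGroup)
  show ?thesis
    unfolding syl_group_def
    by (intro group_action.intro group_hom.intro group_hom_axioms.intro homI
        B.subgroup_imp_group subgroup_syl_perms group_BijGroup)
      (use subgroup.subset[OF subgroup_syl_perms] in auto)
qed

lemma finite_tuples [simp]: "finite (tuples p j)"
  using finite_lists_length_eq[of "{0..<p}" j] by (simp add: tuples_def conj_commute)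

lemma card_tuples: "card (tuples p j) = p ^ j"
  using card_lists_length_eq[of "{0..<p}" j] by (simp add: tuples_def conj_commute)

lemma nth_tuples_less: "x \<in> tuples p t \<Longrightarrow> n < t \<Longrightarrow> x ! n < p"
  by (force simp: tuples_def dest: nth_mem)

lemma length_syl_map [simp]: "length (syl_map p t \<phi> x) = t"
  by (simp add: syl_map_def)

lemma nth_syl_map: "n < t \<Longrightarrow> syl_map p t \<phi> x ! n = (x ! n + \<phi> n (take n x)) mod p"
  by (simp add: syl_map_def)

lemma syl_map_tuples: "p > 0 \<Longrightarrow> syl_map p t \<phi> x \<in> tuples p t"
  by (auto simp: syl_map_def tuples_def)

lemma mod_add_right_inject_nat:
  fixes a b d p :: nat
  assumes "(a + d) mod p = (b + d) mod p" "a < p" "b < p"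
  shows "a = b"
  using assms cong_add_rcancel_nat[of a d b p] by (simp add: cong_def)

text \<open>Equal prefixes induce equal shifts of the next coordinate, and a shift modulo
  \<open>p\<close> is injective on \<open>{0..<p}\<close>. The case \<open>n = t\<close> gives
  injectivity of \<open>syl_map\<close>.\<close>

lemma take_syl_map_eq_iff:
  assumes "n \<le> t" "x \<in> tuples p t" "y \<in> tuples p t"
  shows "take n (syl_map p t \<phi> x) = take n (syl_map p t \<phi> y) \<longleftrightarrow> take n x = take n y"
  using assms(1)
proof (induction n)
  case (Suc n)
  then have n: "n < t" by simp
  have len: "length x = t" "length y = t"
    using assms by (auto simp: tuples_def)
  have "syl_map p t \<phi> x ! n = syl_map p t \<phi> y ! n \<longleftrightarrow> x ! n = y ! n" if "take n x = take n y"
    using that n nth_tuples_less[OF assms(2) n] nth_tuples_less[OF assms(3) n]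
    by (auto simp: nth_syl_map dest: mod_add_right_inject_nat)
  then show ?case
    using Suc n len by (auto simp: take_Suc_conv_app_nth)
qed simp

lemma shift_related_syl_map:
  assumes "n < t" "x \<in> tuples p t" "y \<in> tuples p t"
  shows "shift_related p n d (syl_map p t \<phi> x) (syl_map p t \<phi> y) \<longleftrightarrow> shift_related p n d x y"
proof (cases "take n x = take n y")
  case True
  let ?s = "\<phi> n (take n y)"
  have "[(x ! n + ?s) mod p + d = (y ! n + ?s) mod p] (mod p) \<longleftrightarrow> [(x ! n + d) + ?s = y ! n + ?s] (mod p)"
    by (simp add: cong_def mod_simps add_ac)
  then show ?thesis
    using assms True take_syl_map_eq_iff[of n t x p y \<phi>]
    by (simp add: shift_related_def nth_syl_map cong_add_rcancel_nat)
qed (use assms take_syl_map_eq_iff[of n t x p y \<phi>] in \<open>simp add: shift_related_def\<close>)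

lemma restrict_syl_map_in_syl_perms:
  assumes "p > 0"
  shows "restrict (syl_map p t \<phi>) (tuples p t) \<in> syl_perms p t"
proof -
  have "inj_on (syl_map p t \<phi>) (tuples p t)"
  proof (rule inj_onI)
    fix x y assume "x \<in> tuples p t" "y \<in> tuples p t" "syl_map p t \<phi> x = syl_map p t \<phi> y"
    then show "x = y"
      using take_syl_map_eq_iff[of t t x p y \<phi>] by (simp add: tuples_def)
  qed
  moreover have "syl_map p t \<phi> ` tuples p t \<subseteq> tuples p t"
    using syl_map_tuples[OF assms] by blast
  ultimately have "bij_betw (syl_map p t \<phi>) (tuples p t) (tuples p t)"
    by (simp add: bij_betw_def endo_inj_surj)
  then show ?thesis
    using shift_related_syl_map by (simp add: syl_perms_def Bij_def)
qed

text \<open>An element is a free choice of one shift in \<open>{0..<p}\<close> for every prefix of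
  length below \<open>t\<close>; in particular the group is a p-group. A single function on all
  prefixes replaces the family of \<open>\<phi> j\<close>, since the length of the prefix determines
  \<open>j\<close>.\<close>

lemma order_syl_group:
  assumes "p > 0"
  shows "order (syl_group p t) = p ^ card {a. length a < t \<and> set a \<subseteq> {0..<p}}"
proof -
  let ?I = "{a. length a < t \<and> set a \<subseteq> {0..<p}}"
  let ?F = "\<lambda>\<psi>. restrict (syl_map p t (\<lambda>_. \<psi>)) (tuples p t)"
  \<comment> \<open>Padding with zeros puts 0 at coordinate \<open>length a\<close>, so the image of
    \<open>ext a\<close> shows there exactly the shift that belongs to the prefix
    \<open>a\<close>.\<close>
  define ext where "ext a = a @ replicate (t - length a) (0::nat)" for a
  have ext: "ext a \<in> tuples p t" "take (length a) (ext a) = a" "ext a ! length a = 0" if "a \<in> ?I" for a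
    using that assms by (auto simp: ext_def tuples_def nth_append)
  have finI: "finite ?I"
    by (rule finite_subset[OF _ finite_lists_length_le[of "{0..<p}" t]]) auto
  have "inj_on ?F (?I \<rightarrow>\<^sub>E {0..<p})"
  proof (rule inj_onI)
    fix \<psi> \<psi>' assume psi: "\<psi> \<in> ?I \<rightarrow>\<^sub>E {0..<p}" "\<psi>' \<in> ?I \<rightarrow>\<^sub>E {0..<p}" and eq: "?F \<psi> = ?F \<psi>'"
    show "\<psi> = \<psi>'"
    proof (rule PiE_ext[OF psi])
      fix a assume a: "a \<in> ?I"
      have "syl_map p t (\<lambda>_. \<psi>) (ext a) ! length a = syl_map p t (\<lambda>_. \<psi>') (ext a) ! length a"
        using fun_cong[OF eq, of "ext a"] ext(1)[OF a] by simp
      moreover have "\<psi> a < p" "\<psi>' a < p"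
        using psi a by (auto dest!: PiE_mem)
      ultimately show "\<psi> a = \<psi>' a"
        using a ext[OF a] by (simp add: nth_syl_map)
    qed
  qed
  moreover have "?F ` (?I \<rightarrow>\<^sub>E {0..<p}) = syl_perms p t"
  proof (intro equalityI subsetI)
    fix g assume g: "g \<in> syl_perms p t"
    define \<psi> where "\<psi> = restrict (\<lambda>a. g (ext a) ! length a) ?I"
    have gV: "g x \<in> tuples p t" if "x \<in> tuples p t" for x
      using that g Bij_imp_funcset by (fastforce simp: syl_perms_def)
    have "\<psi> \<in> ?I \<rightarrow>\<^sub>E {0..<p}"
      using nth_tuples_less[OF gV[OF ext(1)]] by (auto simp: \<psi>_def)
    moreover have "g x = syl_map p t (\<lambda>_. \<psi>) x" if x: "x \<in> tuples p t" for x
    proof (rule nth_equalityI)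
      show "length (g x) = length (syl_map p t (\<lambda>_. \<psi>) x)"
        using gV[OF x] by (simp add: tuples_def)
      fix n assume "n < length (g x)"
      then have n: "n < t"
        using gV[OF x] by (simp add: tuples_def)
      let ?a = "take n x"
      have a: "?a \<in> ?I" "length ?a = n"
        using x n by (auto simp: tuples_def dest: in_set_takeD)
      \<comment> \<open>The difference to the padded prefix is \<open>x ! n\<close>; that
        \<open>g\<close> preserves it yields the shift formula for \<open>g x ! n\<close>.\<close>
      have "shift_related p n (x ! n) (ext ?a) x"
        using ext[OF a(1)] a(2) by (simp add: shift_related_def)
      then have "shift_related p n (x ! n) (g (ext ?a)) (g x)"
        using g n ext(1)[OF a(1)] x by (simp add: syl_perms_def)
      then have "[g (ext ?a) ! n + x ! n = g x ! n] (mod p)"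
        by (simp add: shift_related_def)
      then show "g x ! n = syl_map p t (\<lambda>_. \<psi>) x ! n"
        using n a nth_tuples_less[OF gV[OF x] n]
        by (simp add: nth_syl_map \<psi>_def cong_def add.commute)
    qed
    then have "g = ?F \<psi>"
      using g by (auto simp: syl_perms_def Bij_def extensional_def fun_eq_iff)
    ultimately show "g \<in> ?F ` (?I \<rightarrow>\<^sub>E {0..<p})"
      by blast
  qed (use restrict_syl_map_in_syl_perms[OF assms] in auto)
  ultimately have "bij_betw ?F (?I \<rightarrow>\<^sub>E {0..<p}) (syl_perms p t)"
    unfolding bij_betw_def by blast
  then have "card (syl_perms p t) = card (?I \<rightarrow>\<^sub>E {0..<p})"
    by (rule bij_betw_same_card[symmetric])
  then show ?thesis
    using finI by (simp add: order_def card_PiE)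
qed

section \<open>Invariant edge sets as fixed points of the Sylow group\<close>

definition edge_action :: "nat \<Rightarrow> nat \<Rightarrow> (nat list \<Rightarrow> nat list) \<Rightarrow> nat list set \<Rightarrow> nat list set" where
  "edge_action p t g = (\<lambda>e \<in> Pow (tuples p t). g ` e)"

lemma group_action_edge_action: "group_action (syl_group p t) (Pow (tuples p t)) (edge_action p t)"
  using group_action.group_action_Pow[OF group_action_syl_group] by (simp add: edge_action_def[abs_def])

lemma all_pairs_subset_Pow: "all_pairs V \<subseteq> Pow V"
  by (auto simp: all_pairs_def)

lemma edge_action_image:
  "S \<subseteq> all_pairs (tuples p t) \<Longrightarrow> edge_action p t g ` S = (`) g ` S"
  using all_pairs_subset_Pow by (force simp: edge_action_def intro!: image_cong)

text \<open>Maps in \<open>Syl p t\<close> are not extensional, but their restrictions to the tuples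
  lie in \<open>syl_perms p t\<close> and act in the same way on the edges of
  \<open>H\<close>.\<close>

lemma Syl_fixed_point_if_invariant:
  assumes "p > 0" and H: "H \<in> invariant_sets (syl_group p t) (Pow (tuples p t)) (edge_action p t)"
    and HV: "H \<subseteq> all_pairs (tuples p t)"
  shows "Syl_fixed_point p t (tuples p t, H)"
proof -
  have "{{g u, g v} | u v. {u, v} \<in> H} = H" if gS: "g \<in> Syl p t" for g
  proof -
    obtain \<phi> where g: "g = syl_map p t \<phi>"
      using gS unfolding Syl_def by blast
    let ?g = "restrict g (tuples p t)"
    have "(`) ?g ` H = H"
      using H restrict_syl_map_in_syl_perms[OF assms(1), of t \<phi>]
      unfolding invariant_sets_def edge_action_image[OF HV, symmetric] g by simp
    moreover have "(`) ?g ` H = (`) g ` H"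
      using HV all_pairs_subset_Pow[of "tuples p t"] by (intro image_cong) (auto simp: subset_iff)
    moreover have "(`) g ` H = {{g u, g v} | u v. {u, v} \<in> H}"
    proof (intro equalityI subsetI)
      fix e assume "e \<in> (`) g ` H"
      then obtain e' where e': "e' \<in> H" "e = g ` e'" by blast
      then obtain u v where "e' = {u, v}"
        using HV by (auto simp: all_pairs_def)
      with e' show "e \<in> {{g u, g v} | u v. {u, v} \<in> H}" by auto
    next
      fix e assume "e \<in> {{g u, g v} | u v. {u, v} \<in> H}"
      then obtain u v where "e = g ` {u, v}" "{u, v} \<in> H" by auto
      then show "e \<in> (`) g ` H" by blast
    qed
    ultimately show ?thesis by simp
  qed
  then show ?thesis
    using HV by (simp add: Syl_fixed_point_def graph_act_def complete_graph_def)
qed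

section \<open>Complete bipartite subgraphs of invariant graphs\<close>

lemma Cons_tuples: "t \<ge> 1 \<Longrightarrow> i # a \<in> tuples p t \<longleftrightarrow> i < p \<and> a \<in> tuples p (t - 1)"
  by (auto simp: tuples_def)

text \<open>The shifts after coordinate 0 may depend on that coordinate, so tuples that differ in it
  can be moved independently.\<close>

lemma syl_perm_moves_tails:
  assumes "t \<ge> 1" "x \<in> tuples p t" "y \<in> tuples p t" "x ! 0 \<noteq> y ! 0"
    and "a \<in> tuples p (t - 1)" "b \<in> tuples p (t - 1)"
  obtains g where "g \<in> syl_perms p t" "g x = x ! 0 # a" "g y = y ! 0 # b"
proof -
  define x' y' where "x' = x ! 0 # a" and "y' = y ! 0 # b"
  \<comment> \<open>Coordinate 0 stays fixed. The shift taking \<open>x ! n\<close> to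
    \<open>x' ! n\<close> is their difference modulo \<open>p\<close>, with \<open>p - x ! n\<close>
    in place of \<open>- x ! n\<close> to stay in the naturals.\<close>
  define \<phi> where "\<phi> n c = (if n = 0 then 0 else if c ! 0 = x ! 0
    then x' ! n + (p - x ! n) else y' ! n + (p - y ! n))" for n and c :: "nat list"
  have p: "x ! 0 < p" "y ! 0 < p"
    using assms nth_tuples_less[of _ p t 0] by auto
  then have V: "x' \<in> tuples p t" "y' \<in> tuples p t"
    using assms Cons_tuples by (auto simp: x'_def y'_def)
  have "syl_map p t \<phi> x = x'"
  proof (rule nth_equalityI)
    fix n assume "n < length (syl_map p t \<phi> x)"
    then have n: "n < t" by simp
    show "syl_map p t \<phi> x ! n = x' ! n"
      using n nth_tuples_less[OF assms(2) n] nth_tuples_less[OF V(1) n]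
      by (cases "n = 0") (auto simp: nth_syl_map \<phi>_def x'_def)
  qed (use V in \<open>simp add: tuples_def\<close>)
  moreover have "syl_map p t \<phi> y = y'"
  proof (rule nth_equalityI)
    fix n assume "n < length (syl_map p t \<phi> y)"
    then have n: "n < t" by simp
    show "syl_map p t \<phi> y ! n = y' ! n"
      using n nth_tuples_less[OF assms(3) n] nth_tuples_less[OF V(2) n] assms(4)
      by (cases "n = 0") (auto simp: nth_syl_map \<phi>_def y'_def)
  qed (use V in \<open>simp add: tuples_def\<close>)
  ultimately show thesis
    using that[OF restrict_syl_map_in_syl_perms[of p t \<phi>]] p assms(2,3)
    by (simp add: x'_def y'_def)
qed

text \<open>The two sides are the tuples starting with \<open>x ! 0\<close> and those starting with
  \<open>y ! 0\<close>; group elements carry the one edge \<open>{x, y}\<close> to every pair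
  between them.\<close>

lemma contains_complete_bipartite_if_invariant:
  assumes "t \<ge> 1" and H: "H \<in> invariant_sets (syl_group p t) (Pow (tuples p t)) (edge_action p t)"
    and x: "x \<in> tuples p t" and y: "y \<in> tuples p t" and xy: "x ! 0 \<noteq> y ! 0" and edge: "{x, y} \<in> H"
  shows "contains_subgraph (tuples p t, H) (complete_bipartite (p ^ (t - 1)) (p ^ (t - 1)))"
proof -
  have p: "x ! 0 < p" "y ! 0 < p"
    using assms nth_tuples_less[of _ p t 0] by auto
  obtain h where h: "bij_betw h {..<p ^ (t - 1)} (tuples p (t - 1))"
    using ex_bij_betw_nat_finite[OF finite_tuples[of p "t - 1"]]
    by (auto simp: card_tuples atLeast0LessThan)
  define f where "f v = (case v of Inl i \<Rightarrow> x ! 0 # h i | Inr j \<Rightarrow> y ! 0 # h j)" for v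
  have hV: "h i \<in> tuples p (t - 1)" if "i < p ^ (t - 1)" for i
    using h that by (auto simp: bij_betw_def)
  have edges: "{x ! 0 # h i, y ! 0 # h j} \<in> H" if ij: "i < p ^ (t - 1)" "j < p ^ (t - 1)" for i j
  proof -
    obtain g where g: "g \<in> syl_perms p t" "g x = x ! 0 # h i" "g y = y ! 0 # h j"
      using syl_perm_moves_tails[OF assms(1) x y xy hV[OF ij(1)] hV[OF ij(2)]] by blast
    have "edge_action p t g {x, y} \<in> H"
      using H g(1) edge unfolding invariant_sets_def by fastforce
    then show ?thesis
      using x y g by (simp add: edge_action_def)
  qed
  show ?thesis
    unfolding contains_subgraph_def
  proof (intro exI[of _ f] conjI allI impI)
    show "inj_on f (verts (complete_bipartite (p ^ (t - 1)) (p ^ (t - 1))))"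
      using h xy by (auto simp: complete_bipartite_def f_def inj_on_def bij_betw_def)
    show "f ` verts (complete_bipartite (p ^ (t - 1)) (p ^ (t - 1))) \<subseteq> verts (tuples p t, H)"
      using hV p by (auto simp: complete_bipartite_def f_def Cons_tuples[OF assms(1)])
    fix u v assume "{u, v} \<in> edges (complete_bipartite (p ^ (t - 1)) (p ^ (t - 1)))"
    then obtain i j where "i < p ^ (t - 1)" "j < p ^ (t - 1)" "{u, v} = {Inl i, Inr j}"
      by (auto simp: complete_bipartite_def)
    then show "{f u, f v} \<in> edges (tuples p t, H)"
      using edges by (auto simp: doubleton_eq_iff f_def insert_commute)
  qed
qed

section \<open>The chain of complete multipartite graphs from the empty to the complete
  graph\<close>

text \<open>The parts are the classes of tuples with a common prefix of length \<open>n\<close>. The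
  case \<open>n = 0\<close> has no edges, \<open>n = 1\<close> is the set \<open>M\<close> of the
  idea above, and \<open>n = t\<close> gives all pairs.\<close>

definition prefix_edges :: "nat \<Rightarrow> nat \<Rightarrow> nat \<Rightarrow> nat list set set" where
  "prefix_edges p t n = {{x, y} | x y. x \<in> tuples p t \<and> y \<in> tuples p t \<and> take n x \<noteq> take n y}"

lemma prefix_edges_subset: "prefix_edges p t n \<subseteq> all_pairs (tuples p t)"
  by (auto simp: prefix_edges_def all_pairs_def)

lemma doubleton_in_prefix_edges:
  "{x, y} \<in> prefix_edges p t n \<longleftrightarrow> x \<in> tuples p t \<and> y \<in> tuples p t \<and> take n x \<noteq> take n y"
  by (auto simp: prefix_edges_def doubleton_eq_iff)

lemma take_syl_perm_eq_iff:
  assumes "p > 0" and g: "g \<in> syl_perms p t" and "n \<le> t" and x: "x \<in> tuples p t" and y: "y \<in> tuples p t"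
  shows "take n (g x) = take n (g y) \<longleftrightarrow> take n x = take n y"
proof (cases "n = t")
  \<comment> \<open>There is no coordinate \<open>t\<close> for \<open>shift_related\<close> to
    compare, so this case rests on injectivity of \<open>g\<close>.\<close>
  case True
  have "g x \<in> tuples p t" "g y \<in> tuples p t" "g x = g y \<longleftrightarrow> x = y"
    using g x y Bij_imp_funcset by (auto simp: syl_perms_def Bij_def bij_betw_def inj_on_def)
  then show ?thesis
    using True x y by (simp add: tuples_def)
next
  case False
  have *: "take n u = take n v \<longleftrightarrow> (\<exists>d. shift_related p n d u v)" for u v
  proof -
    \<comment> \<open>The witness for \<open>d\<close> is \<open>v ! n - u ! n\<close> modulo
      \<open>p\<close>, with \<open>p - 1\<close> standing for \<open>-1\<close>.\<close>
    have "u ! n + ((p - 1) * u ! n + v ! n) = p * u ! n + v ! n"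
      using assms(1) by (cases p) auto
    then have "[u ! n + ((p - 1) * u ! n + v ! n) = v ! n] (mod p)"
      unfolding cong_def by (metis mod_mult_self4)
    then show ?thesis
      by (auto simp: shift_related_def)
  qed
  show ?thesis
    using False assms unfolding * by (auto simp: syl_perms_def)
qed

lemma prefix_edges_invariant:
  assumes "p > 0" "n \<le> t"
  shows "prefix_edges p t n \<in> invariant_sets (syl_group p t) (Pow (tuples p t)) (edge_action p t)"
proof (rule group_action.invariant_setsI[OF group_action_edge_action])
  show "prefix_edges p t n \<subseteq> Pow (tuples p t)"
    using prefix_edges_subset all_pairs_subset_Pow by blast
  fix g e assume "g \<in> carrier (syl_group p t)" and e: "e \<in> prefix_edges p t n"
  then have g: "g \<in> syl_perms p t" by simp
  then have gV: "g x \<in> tuples p t" if "x \<in> tuples p t" for x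
    using that Bij_imp_funcset by (fastforce simp: syl_perms_def)
  obtain x y where "e = {x, y}" "x \<in> tuples p t" "y \<in> tuples p t" "take n x \<noteq> take n y"
    using e by (auto simp: prefix_edges_def)
  then show "edge_action p t g e \<in> prefix_edges p t n"
    using take_syl_perm_eq_iff[OF assms(1) g assms(2)] gV
    by (simp add: edge_action_def doubleton_in_prefix_edges)
qed

section \<open>Relabelling of vertices and rotation of coordinates\<close>

lemma image_all_pairs_iso:
  assumes S: "S \<subseteq> all_pairs V" and f: "bij_betw f V W"
  shows "(`) f ` S \<subseteq> all_pairs W" "graph_iso (V, S) (W, (`) f ` S)"
proof -
  have fW: "f u \<in> W" if "u \<in> V" for u
    using f that by (auto simp: bij_betw_def)
  have inj: "inj_on f V"
    using f by (simp add: bij_betw_def)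
  show "(`) f ` S \<subseteq> all_pairs W"
  proof clarify
    fix e assume "e \<in> S"
    then obtain u v where uv: "e = {u, v}" "u \<in> V" "v \<in> V" "u \<noteq> v"
      using S by (auto simp: all_pairs_def)
    then have "f u \<noteq> f v"
      using inj by (simp add: inj_on_eq_iff)
    then show "f ` e \<in> all_pairs W"
      using uv fW by (auto simp: all_pairs_def)
  qed
  have "{u, v} \<in> S \<longleftrightarrow> {f u, f v} \<in> (`) f ` S" if "u \<in> V" "v \<in> V" for u v
  proof
    assume "{f u, f v} \<in> (`) f ` S"
    then obtain e where e: "e \<in> S" "f ` {u, v} = f ` e" by auto
    moreover have "e \<subseteq> V"
      using e(1) S all_pairs_subset_Pow by blast
    ultimately show "{u, v} \<in> S"
      using that inj_on_image_eq_iff[OF inj, of "{u, v}" e] by auto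
  qed (metis image_empty image_eqI image_insert)
  then show "graph_iso (V, S) (W, (`) f ` S)"
    using f by (auto simp: graph_iso_def)
qed

lemma bij_betw_rotate1_tuples: "bij_betw rotate1 (tuples p t) (tuples p t)"
proof -
  have "inj_on rotate1 (tuples p t)"
    using inj_rotate1 inj_on_subset by blast
  moreover have "rotate1 ` tuples p t \<subseteq> tuples p t"
    by (auto simp: tuples_def)
  ultimately show ?thesis
    by (simp add: bij_betw_def endo_inj_surj)
qed

text \<open>The remaining pairs agree at coordinate 0 and differ at one of the coordinates 1 to
  \<open>n\<close>, which the rotation moves to 0 to \<open>n - 1\<close>.\<close>

lemma rotate1_prefix_edges:
  assumes "n < t"
  shows "(`) rotate1 ` (prefix_edges p t (Suc n) - prefix_edges p t 1) \<subseteq> prefix_edges p t n"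
proof clarify
  fix e assume "e \<in> prefix_edges p t (Suc n)" and e1: "e \<notin> prefix_edges p t 1"
  then obtain x y where e: "e = {x, y}" and xy: "x \<in> tuples p t" "y \<in> tuples p t"
      "take (Suc n) x \<noteq> take (Suc n) y"
    by (auto simp: prefix_edges_def)
  obtain i a j b where xa: "x = i # a" "y = j # b"
    using xy assms by (cases x; cases y) (auto simp: tuples_def)
  have "i = j"
    using e1 xy by (simp add: e doubleton_in_prefix_edges xa)
  then have "take n (rotate1 x) \<noteq> take n (rotate1 y)"
    using xy assms by (auto simp: xa tuples_def)
  moreover have "rotate1 x \<in> tuples p t" "rotate1 y \<in> tuples p t"
    using xy by (auto simp: tuples_def)
  ultimately show "rotate1 ` e \<in> prefix_edges p t n"
    by (simp add: e doubleton_in_prefix_edges)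
qed

section \<open>Vanishing enumerators force the parameter to be constant\<close>

theorem theorem4p1:
  fixes p t c :: nat and \<Phi> :: "nat list graph \<Rightarrow> nat"
  assumes "prime p" and "t \<ge> 1"
    and "graph_parameter \<Phi>" and "edge_monotone \<Phi>"
    and "\<And>G. is_graph G \<Longrightarrow> \<Phi> G \<in> {0..c}" and "c < p"
    and "nontrivial_on \<Phi> (p ^ t)"
  shows "\<exists>H. Syl_fixed_point p t H \<and>
           contains_subgraph H (complete_bipartite (p ^ (t - 1)) (p ^ (t - 1))) \<and>
           \<not> [alt_enum \<Phi> H = 0] (mod int p) \<and> alt_enum \<Phi> H \<noteq> 0"
proof (rule ccontr)
  assume contra: "\<not> ?thesis"
  let ?V = "tuples p t" and ?E = "prefix_edges p t"
  let ?Inv = "invariant_sets (syl_group p t) (Pow ?V) (edge_action p t)"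
  interpret group_action "syl_group p t" "Pow ?V" "edge_action p t"
    by (rule group_action_edge_action)
  have p: "p > 0"
    using assms(1) prime_gt_0_nat by blast
  have graph: "is_graph (?V, S)" if "S \<subseteq> all_pairs ?V" for S
    using that by (simp add: is_graph_def)
  \<comment> \<open>Serves three relabellings: by group elements, by the rotation, and of an
    arbitrary graph with \<open>p ^ t\<close> vertices onto the tuples.\<close>
  have iso: "(`) f ` edges G \<subseteq> all_pairs ?V" "\<Phi> G = \<Phi> (?V, (`) f ` edges G)"
    if G: "is_graph G" and f: "bij_betw f (verts G) ?V" for G f
  proof -
    have "edges G \<subseteq> all_pairs (verts G)"
      using G by (simp add: is_graph_def)
    note image = image_all_pairs_iso[OF this f]
    show "(`) f ` edges G \<subseteq> all_pairs ?V"
      by (rule image)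
    show "\<Phi> G = \<Phi> (?V, (`) f ` edges G)"
      using assms(3) G graph[OF image(1)] image(2) by (simp add: graph_parameter_def del: split_paired_All)
  qed
  have mono: "\<Phi> (?V, T) \<le> \<Phi> (?V, S)" if "S \<subseteq> T" "T \<subseteq> all_pairs ?V" for S T
    using that assms(4) graph[of S] graph[of T] by (auto simp: edge_monotone_def)

  have vanish: "[(\<Sum>S\<in>Pow H. int (\<Phi> (?V, S)) * (-1) ^ card S) = 0] (mod int p)"
    if H: "H \<in> ?Inv" "H \<subseteq> all_pairs ?V" "H \<inter> ?E 1 \<noteq> {}" for H
  proof -
    obtain x y where xy: "{x, y} \<in> H" "x \<in> ?V" "y \<in> ?V" "take 1 x \<noteq> take 1 y"
      using H(3) by (auto simp: prefix_edges_def)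
    then have "x ! 0 \<noteq> y ! 0"
      using assms(2) by (cases x; cases y) (auto simp: tuples_def)
    then have "contains_subgraph (?V, H) (complete_bipartite (p ^ (t - 1)) (p ^ (t - 1)))"
      using contains_complete_bipartite_if_invariant[OF assms(2) H(1)] xy by blast
    moreover have "Syl_fixed_point p t (?V, H)"
      by (rule Syl_fixed_point_if_invariant[OF p H(1,2)])
    ultimately have "[alt_enum \<Phi> (?V, H) = 0] (mod int p)"
      \<comment> \<open>An enumerator equal to 0 is also congruent to 0, so negating the last two
        conjuncts of the claim together gives the congruence.\<close>
      using contra by (metis cong_refl)
    then show ?thesis
      by (simp add: alt_enum_def)
  qed

  have remove: "\<Phi> (?V, ?E n) = \<Phi> (?V, ?E n - ?E 1)" if "n \<le> t" for n
  proof -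
    have "[int (\<Phi> (?V, ?E n)) = int (\<Phi> (?V, ?E n - ?E 1))] (mod int p)"
    proof (rule invariant_cong_remove[where f = "\<lambda>S. int (\<Phi> (?V, S))"])
      show "?E 1 \<in> ?Inv" "?E n \<in> ?Inv"
        using prefix_edges_invariant p assms(2) that by auto
      show "int (\<Phi> (?V, edge_action p t g ` S)) = int (\<Phi> (?V, S))"
        if "g \<in> carrier (syl_group p t)" "S \<subseteq> ?E n" for g S
      proof -
        have S: "S \<subseteq> all_pairs ?V"
          using that(2) prefix_edges_subset by blast
        have "bij_betw g ?V ?V"
          using that(1) by (simp add: syl_perms_def Bij_def)
        then show ?thesis
          using iso(2)[OF graph[OF S]] by (simp add: edge_action_image[OF S])
      qed
      show "[(\<Sum>S\<in>Pow H. int (\<Phi> (?V, S)) * (-1) ^ card S) = 0] (mod int p)"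
        if "H \<in> ?Inv" "H \<subseteq> ?E n" "H \<inter> ?E 1 \<noteq> {}" for H
        using vanish that prefix_edges_subset by blast
    qed (use assms(1) order_syl_group[OF p] in auto)
    \<comment> \<open>Here \<open>c < p\<close> enters: values below \<open>p\<close> that are
      congruent modulo \<open>p\<close> are equal.\<close>
    moreover have "\<Phi> (?V, S) < p" if "S \<subseteq> all_pairs ?V" for S
      using assms(5)[OF graph[OF that]] assms(6) by simp
    then have "\<Phi> (?V, ?E n) < p" "\<Phi> (?V, ?E n - ?E 1) < p"
      using prefix_edges_subset[of p t n] by (simp_all add: Diff_subset[THEN subset_trans])
    ultimately show ?thesis
      by (simp add: cong_int_iff cong_less_modulus_unique_nat)
  qed

  have chain: "\<Phi> (?V, {}) \<le> \<Phi> (?V, ?E n)" if "n \<le> t" for n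
    using that
  proof (induction n)
    case 0
    then show ?case
      by (simp add: prefix_edges_def)
  next
    case (Suc n)
    let ?D = "?E (Suc n) - ?E 1"
    have D: "?D \<subseteq> all_pairs ?V"
      using prefix_edges_subset by blast
    have "\<Phi> (?V, {}) \<le> \<Phi> (?V, ?E n)"
      using Suc by simp
    \<comment> \<open>The rotated graph is a subgraph of \<open>?E n\<close>, and deleting edges
      cannot decrease \<open>\<Phi>\<close>.\<close>
    also have "\<dots> \<le> \<Phi> (?V, (`) rotate1 ` ?D)"
      by (rule mono[OF rotate1_prefix_edges prefix_edges_subset]) (use Suc in simp)
    also have "\<dots> = \<Phi> (?V, ?D)"
      using iso(2)[OF graph[OF D], of rotate1] bij_betw_rotate1_tuples[of p t] by simp
    also have "\<dots> = \<Phi> (?V, ?E (Suc n))"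
      using remove Suc by simp
    finally show ?case .
  qed
  have "take t x = x" if "x \<in> ?V" for x
    using that by (simp add: tuples_def)
  then have "?E t = all_pairs ?V"
    by (simp add: prefix_edges_def all_pairs_def cong: conj_cong)
  then have extremes: "\<Phi> (?V, {}) \<le> \<Phi> (?V, all_pairs ?V)"
    using chain[of t] by simp
  have "\<Phi> G = \<Phi> (?V, {})" if G: "is_graph G" "card (verts G) = p ^ t" for G
  proof -
    obtain f where "bij_betw f (verts G) ?V"
      using finite_same_card_bij[of "verts G" ?V] G by (auto simp: is_graph_def card_tuples)
    note iso = iso[OF G(1) this]
    show ?thesis
      \<comment> \<open>The value at \<open>G\<close> lies between those at the complete and the
        empty graph, which coincide by \<open>extremes\<close>.\<close>
      using mono[OF iso(1) order_refl] mono[OF empty_subsetI iso(1)] extremes iso(2) by linarith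
  qed
  then show False
    using assms(7) unfolding nontrivial_on_def by force
qed

end
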